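(* Let $\mathcal{A}$ be a Leibniz algebra over a field $F$ of characteristic zero and let $B, C$ be two nilpotent subinvariant subalgebras of $\mathcal{A}$. Then the subalgebra $D$ generated by $B$ and $C$ is a nilpotent subinvariant subalgebra of $\mathcal{A}$.
   Context: A Leibniz algebra over a field $F$ means a finite-dimensional left Leibniz algebra: a finite-dimensional $F$-vector space with a bilinear product $(x,y)\mapsto xy$ such that $x(yz) = (xy)z + y(xz)$ for all $x,y,z$. Ideals are two-sided; $I \vartriangleleft J$ means $I$ is an ideal of $J$. Set $\mathcal{A}^1 = \mathcal{A}$ and $\mathcal{A}^{i} = \mathcal{A}\mathcal{A}^{i-1}$ (linear span of products) for $i \ge 2$; $\mathcal{A}$ is nilpotent if $\mathcal{A}^m = \{0\}$ for some positive integer $m$. A subalgebra $B$ of $\mathcal{A}$ is subinvariant in $\mathcal{A}$ if there is a chain of subalgebras $B = B_t \subset B_{t-1} \subset \cdots \subset B_0 = \mathcal{A}$ with $B_i \vartriangleleft B_{i-1}$ for all $1 \leq i \leq t$. *)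

theory Defs
  imports Complex_Main
begin

locale leibniz_algebra = vector_space scale
  for scale :: "'f::field \<Rightarrow> 'a::ab_group_add \<Rightarrow> 'a" (infixr \<open>*s\<close> 75) +
  fixes mult :: "'a \<Rightarrow> 'a \<Rightarrow> 'a" (infixl \<open>\<cdot>\<close> 70)
  assumes linear_mult_left: "Vector_Spaces.linear (*s) (*s) (\<lambda>x. x \<cdot> y)"
    and linear_mult_right: "Vector_Spaces.linear (*s) (*s) (\<lambda>y. x \<cdot> y)"
    and left_leibniz: "x \<cdot> (y \<cdot> z) = (x \<cdot> y) \<cdot> z + y \<cdot> (x \<cdot> z)"
    and finite_dimensional: "\<exists>S. finite S \<and> span S = UNIV"
begin

definition subalgebra :: "'a set \<Rightarrow> bool" where
  "subalgebra B \<longleftrightarrow> subspace B \<and> (\<forall>x\<in>B. \<forall>y\<in>B. x \<cdot> y \<in> B)"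

definition ideal_of :: "'a set \<Rightarrow> 'a set \<Rightarrow> bool" where
  "ideal_of I J \<longleftrightarrow> subspace I \<and> I \<subseteq> J \<and> (\<forall>x\<in>J. \<forall>y\<in>I. x \<cdot> y \<in> I \<and> y \<cdot> x \<in> I)"

text \<open>The powers are indexed from \<open>0\<close>: \<open>lower_central B n\<close> is \<open>B\<^sup>n\<^sup>+\<^sup>1\<close>, where
  \<open>B\<^sup>1 = B\<close> and \<open>B\<^sup>i = B B\<^sup>i\<^sup>-\<^sup>1\<close>.\<close>

primrec lower_central :: "'a set \<Rightarrow> nat \<Rightarrow> 'a set" where
  "lower_central B 0 = B"
| "lower_central B (Suc n) = span {x \<cdot> y | x y. x \<in> B \<and> y \<in> lower_central B n}"

definition nilpotent :: "'a set \<Rightarrow> bool" where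
  "nilpotent B \<longleftrightarrow> (\<exists>n. lower_central B n = {0})"

definition subinvariant :: "'a set \<Rightarrow> bool" where
  "subinvariant B \<longleftrightarrow>
    (\<exists>t. \<exists>S :: nat \<Rightarrow> 'a set. S 0 = UNIV \<and> S t = B \<and> (\<forall>i\<le>t. subalgebra (S i)) \<and>
      (\<forall>i. 1 \<le> i \<and> i \<le> t \<longrightarrow> ideal_of (S i) (S (i - 1))))"

definition generated_subalgebra :: "'a set \<Rightarrow> 'a set" where
  "generated_subalgebra X = subalgebra hull X"

end

end

theory Submission
  imports Defs "HOL-Library.Function_Algebras"
begin

text \<open>The key point is that, for an ideal \<open>I\<close> of a subalgebra \<open>J\<close>, the largest nilpotent ideal \<open>N\<close>
  of \<open>I\<close> lies in a nilpotent ideal of \<open>J\<close>; climbing the two chains then puts \<open>B\<close> and \<open>C\<close>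
  in nilpotent ideals of the whole algebra, and every subalgebra of the nilpotent ideal they span
  is nilpotent and subinvariant.

  For \<open>z\<close> in \<open>J\<close> the left multiplication \<open>L\<^sub>z\<close> is a derivation of \<open>I\<close>, so in characteristic zero
  \<open>exp (t L\<^sub>z)\<close> is an automorphism of the power series algebra \<open>I[[t]]\<close>. The ideal \<open>N[[t]]\<close> and its
  translate by this automorphism are nilpotent, hence so is their sum, and therefore so is
  the ideal of leading coefficients of that sum, which contains \<open>z n\<close> for every \<open>n\<close> in \<open>N\<close>.
  By maximality \<open>N\<close> is closed under left multiplication by \<open>J\<close>. Right multiples cost nothing,
  since \<open>n x\<close> and \<open>- (x n)\<close> have the same left multiplication operator.\<close>

section \<open>Bilinear products and the join of two filtrations\<close>

locale bilinear_algebra = vector_space scale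
  for scale :: "'f::field \<Rightarrow> 'a::ab_group_add \<Rightarrow> 'a" (infixr \<open>*s\<close> 75) +
  fixes mult :: "'a \<Rightarrow> 'a \<Rightarrow> 'a" (infixl \<open>\<cdot>\<close> 70)
  assumes linear_left: "Vector_Spaces.linear (*s) (*s) (\<lambda>x. x \<cdot> y)"
    and linear_right: "Vector_Spaces.linear (*s) (*s) (\<lambda>y. x \<cdot> y)"
begin

lemma module_hom_left: "module_hom (*s) (*s) (\<lambda>x. x \<cdot> y)"
  using linear_left by (simp add: linear_iff_module_hom)

lemma module_hom_right: "module_hom (*s) (*s) (\<lambda>y. x \<cdot> y)"
  using linear_right by (simp add: linear_iff_module_hom)

lemmas add_mult = module_hom.add[OF module_hom_left]
  and neg_mult = module_hom.neg[OF module_hom_left]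
  and scale_mult = module_hom.scale[OF module_hom_left]
  and zero_mult [simp] = module_hom.zero[OF module_hom_left]
  and sum_mult = module_hom.sum[OF module_hom_left]
  and mult_add = module_hom.add[OF module_hom_right]
  and mult_scale = module_hom.scale[OF module_hom_right]
  and mult_zero [simp] = module_hom.zero[OF module_hom_right]
  and mult_sum = module_hom.sum[OF module_hom_right]

lemma subspace_mult_left: "subspace U \<Longrightarrow> subspace {x. x \<cdot> y \<in> U}"
  by (simp add: subspace_def add_mult scale_mult)

lemma subspace_mult_right: "subspace U \<Longrightarrow> subspace {y. x \<cdot> y \<in> U}"
  by (simp add: subspace_def mult_add mult_scale)

lemma mult_span_right:
  assumes "y \<in> span T" "subspace U" "\<And>t. t \<in> T \<Longrightarrow> x \<cdot> t \<in> U"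
  shows "x \<cdot> y \<in> U"
  using span_minimal[of T "{y. x \<cdot> y \<in> U}"] assms subspace_mult_right by blast

lemma mult_span_left:
  assumes "x \<in> span T" "subspace U" "\<And>t. t \<in> T \<Longrightarrow> t \<cdot> y \<in> U"
  shows "x \<cdot> y \<in> U"
  using span_minimal[of T "{x. x \<cdot> y \<in> U}"] assms subspace_mult_left by blast

lemma mult_span_span:
  assumes "x \<in> span S" "y \<in> span T" "subspace U" "\<And>s t. s \<in> S \<Longrightarrow> t \<in> T \<Longrightarrow> s \<cdot> t \<in> U"
  shows "x \<cdot> y \<in> U"
  using assms(1,3)
proof (rule mult_span_left)
  show "s \<cdot> y \<in> U" if "s \<in> S" for s
    using assms(2,3) by (rule mult_span_right) (use assms(4) that in blast)
qed

text \<open>With \<open>P\<close> and \<open>Q\<close> the powers of two ideals, this is used to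
  filter the sum of the ideals. Intersections replace products of powers, so that vanishing becomes
  a matter of counting indices.\<close>

definition filtration_join :: "(nat \<Rightarrow> 'a set) \<Rightarrow> (nat \<Rightarrow> 'a set) \<Rightarrow> nat \<Rightarrow> 'a set" where
  "filtration_join P Q k = span (\<Union>i\<le>k. P i \<inter> Q (k - i))"

lemma filtration_join_base: "x \<in> P i \<Longrightarrow> x \<in> Q j \<Longrightarrow> x \<in> filtration_join P Q (i + j)"
  unfolding filtration_join_def by (rule span_base) force

text \<open>A generator of degree 1 lies in \<open>P 1 \<inter> Q 0\<close> or in
  \<open>P 0 \<inter> Q 1\<close>, so left multiplication by it raises one index by one and keeps
  the other. Hence only left factors of index at most 1 matter.\<close>

lemma filtration_join_mult:
  assumes "\<And>i k x y. i \<le> 1 \<Longrightarrow> x \<in> P i \<Longrightarrow> y \<in> P k \<Longrightarrow> x \<cdot> y \<in> P (i + k)"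
    and "\<And>i k x y. i \<le> 1 \<Longrightarrow> x \<in> Q i \<Longrightarrow> y \<in> Q k \<Longrightarrow> x \<cdot> y \<in> Q (i + k)"
    and "x \<in> filtration_join P Q 1" "y \<in> filtration_join P Q k"
  shows "x \<cdot> y \<in> filtration_join P Q (Suc k)"
proof (rule mult_span_span)
  show "x \<in> span (\<Union>i\<le>1. P i \<inter> Q (1 - i))" "y \<in> span (\<Union>i\<le>k. P i \<inter> Q (k - i))"
    using assms(3,4) by (simp_all only: filtration_join_def)
  show "subspace (filtration_join P Q (Suc k))"
    by (simp add: filtration_join_def)
  fix s t
  assume "s \<in> (\<Union>i\<le>1. P i \<inter> Q (1 - i))" "t \<in> (\<Union>i\<le>k. P i \<inter> Q (k - i))"
  then obtain i j where ij: "i \<le> 1" "s \<in> P i" "s \<in> Q (1 - i)" "j \<le> k" "t \<in> P j" "t \<in> Q (k - j)"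
    by blast
  have "s \<cdot> t \<in> P (i + j)" "s \<cdot> t \<in> Q (1 - i + (k - j))"
    by (rule assms(1,2); use ij in simp)+
  moreover have "i + j + (1 - i + (k - j)) = Suc k"
    using ij by simp
  ultimately show "s \<cdot> t \<in> filtration_join P Q (Suc k)"
    by (metis filtration_join_base)
qed

text \<open>Pigeonhole: \<open>p + q \<le> k\<close> forces \<open>p \<le> i\<close> or
  \<open>q \<le> k - i\<close>.\<close>

lemma filtration_join_trivial:
  assumes "\<And>i. p \<le> i \<Longrightarrow> P i \<subseteq> {0}" "\<And>i. q \<le> i \<Longrightarrow> Q i \<subseteq> {0}" "p + q \<le> k"
  shows "filtration_join P Q k = {0}"
proof -
  have "P i \<inter> Q (k - i) \<subseteq> {0}" for i
  proof (cases "p \<le> i")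
    case True
    then show ?thesis using assms(1) by blast
  next
    case False
    then have "q \<le> k - i" using assms(3) by simp
    then show ?thesis using assms(2) by blast
  qed
  then have "(\<Union>i\<le>k. P i \<inter> Q (k - i)) \<subseteq> {0}" by blast
  then show ?thesis
    unfolding filtration_join_def by (metis span_empty span_insert_0 subset_singletonD)
qed

end

sublocale leibniz_algebra \<subseteq> bilinear_algebra scale mult
  by (intro bilinear_algebra.intro bilinear_algebra_axioms.intro vector_space_axioms
      linear_mult_left linear_mult_right)

section \<open>Powers of ideals, the nilradical, and closure under right multiples\<close>

context leibniz_algebra
begin

lemma lower_central_trivial: "p \<le> k \<Longrightarrow> lower_central N p = {0} \<Longrightarrow> lower_central N k \<subseteq> {0}"
proof (induction rule: dec_induct)
  case (step k)
  then have "{x \<cdot> y |x y. x \<in> N \<and> y \<in> lower_central N k} \<subseteq> {0}" by auto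
  then show ?case using span_minimal subspace_single_0 by simp
qed simp

lemma subspace_lower_central: "subspace N \<Longrightarrow> subspace (lower_central N k)"
  by (cases k) auto

lemma zero_in_lower_central: "subspace N \<Longrightarrow> 0 \<in> lower_central N k"
  by (simp add: subspace_0 subspace_lower_central)

lemma lower_central_subset_filtration:
  assumes "\<And>k. subspace (R k)" "H \<subseteq> R 1"
    and "\<And>k x y. x \<in> R 1 \<Longrightarrow> y \<in> R k \<Longrightarrow> x \<cdot> y \<in> R (Suc k)"
  shows "lower_central H k \<subseteq> R (Suc k)"
proof (induction k)
  case 0
  then show ?case using assms(2) by simp
next
  case (Suc k)
  have "{x \<cdot> y |x y. x \<in> H \<and> y \<in> lower_central H k} \<subseteq> R (Suc (Suc k))"
    using Suc assms(2,3) by blast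
  then show ?case using assms(1) by (simp add: span_minimal)
qed

text \<open>Criterion for the sum of two ideals and for the left translate. \<open>R\<close> counts
  factors, so \<open>lower_central H k\<close> lies in \<open>R (Suc k)\<close>.\<close>

lemma nilpotent_filtration:
  assumes "\<And>k. subspace (R k)" "subspace H" "H \<subseteq> R 1"
    and "\<And>k x y. x \<in> R 1 \<Longrightarrow> y \<in> R k \<Longrightarrow> x \<cdot> y \<in> R (Suc k)" "R (Suc k) \<subseteq> {0}"
  shows "nilpotent H"
proof -
  have "lower_central H k \<subseteq> {0}"
    using lower_central_subset_filtration[of R H k] assms by blast
  then show ?thesis
    using zero_in_lower_central[OF assms(2), of k] unfolding nilpotent_def by blast
qed

text \<open>Left multiplication by \<open>x\<close> is a derivation, and both terms of
  \<open>x (a b) = (x a) b + a (x b)\<close> keep the number of factors from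
  \<open>N\<close>.\<close>

lemma lower_central_left_stable:
  assumes "\<And>x y. x \<in> I \<Longrightarrow> y \<in> N \<Longrightarrow> x \<cdot> y \<in> N" "x \<in> I" "y \<in> lower_central N k"
  shows "x \<cdot> y \<in> lower_central N k"
  using assms(2,3)
proof (induction k arbitrary: x y)
  case (Suc k)
  have "y \<in> span {x \<cdot> y |x y. x \<in> N \<and> y \<in> lower_central N k}"
    using Suc.prems by simp
  then show ?case
  proof (rule mult_span_right)
    fix t
    assume "t \<in> {x \<cdot> y |x y. x \<in> N \<and> y \<in> lower_central N k}"
    then obtain a b where ab: "t = a \<cdot> b" "a \<in> N" "b \<in> lower_central N k" by blast
    have "(x \<cdot> a) \<cdot> b \<in> lower_central N (Suc k)" "a \<cdot> (x \<cdot> b) \<in> lower_central N (Suc k)"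
      using ab assms(1) Suc.IH[of x b] Suc.prems(1) by (auto intro!: span_base)
    then show "x \<cdot> t \<in> lower_central N (Suc k)"
      unfolding ab(1) left_leibniz[of x] by (simp add: span_add)
  qed simp
qed (simp add: assms(1))

text \<open>The index is the number of factors from \<open>N\<close>, so it is one ahead of that of
  \<^const>\<open>lower_central\<close>.\<close>

primrec ideal_power :: "'a set \<Rightarrow> 'a set \<Rightarrow> nat \<Rightarrow> 'a set" where
  "ideal_power I N 0 = I"
| "ideal_power I N (Suc k) = lower_central N k"

text \<open>A left factor from \<open>I\<close> acts as a derivation preserving each power; a left
  factor from \<open>N\<close> raises the power by definition.\<close>

lemma ideal_power_mult:
  assumes "subalgebra I" "ideal_of N I"
    and "i \<le> 1" "x \<in> ideal_power I N i" "y \<in> ideal_power I N k"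
  shows "x \<cdot> y \<in> ideal_power I N (i + k)"
proof (cases "i = 0")
  case True
  then show ?thesis
    using assms lower_central_left_stable[of I N x y] unfolding subalgebra_def ideal_of_def
    by (cases k) auto
next
  case False
  then have "i = 1" using assms by simp
  then show ?thesis
    using assms unfolding ideal_of_def by (cases k) (auto intro!: span_base)
qed

lemma ideal_power_trivial:
  "lower_central N p = {0} \<Longrightarrow> Suc p \<le> k \<Longrightarrow> ideal_power I N k \<subseteq> {0}"
  using lower_central_trivial[of p "k - 1" N] by (cases k) auto

lemma subspace_ideal_power: "subspace I \<Longrightarrow> subspace N \<Longrightarrow> subspace (ideal_power I N k)"
  by (cases k) (auto simp: subspace_lower_central)

lemma ideal_of_span:
  assumes "subspace J" "S \<subseteq> J"
    and "\<And>x s. x \<in> J \<Longrightarrow> s \<in> S \<Longrightarrow> x \<cdot> s \<in> span S" "\<And>x s. x \<in> J \<Longrightarrow> s \<in> S \<Longrightarrow> s \<cdot> x \<in> span S"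
  shows "ideal_of (span S) J"
  unfolding ideal_of_def
  using assms by (auto intro: mult_span_right[of _ S] mult_span_left[of _ S] span_minimal[THEN subsetD])

lemma ideal_of_sum:
  assumes "subspace J" "ideal_of M J" "ideal_of N J"
  shows "ideal_of (span (M \<union> N)) J"
  using assms by (intro ideal_of_span) (auto simp: ideal_of_def intro: span_base)

text \<open>The join of the two power filtrations contains \<open>M\<close> and \<open>N\<close> in
  degree 1, the one as \<open>P 1 \<inter> Q 0\<close>, the other as
  \<open>P 0 \<inter> Q 1\<close>, and it vanishes in high degree.\<close>

lemma nilpotent_sum:
  assumes "subalgebra I" "ideal_of M I" "ideal_of N I" "nilpotent M" "nilpotent N"
  shows "nilpotent (span (M \<union> N))"
proof -
  define R where "R = filtration_join (ideal_power I M) (ideal_power I N)"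
  obtain p q where pq: "lower_central M p = {0}" "lower_central N q = {0}"
    using assms(4,5) unfolding nilpotent_def by blast
  show ?thesis
  proof (rule nilpotent_filtration)
    show "subspace (R k)" for k by (simp add: R_def filtration_join_def)
    show "span (M \<union> N) \<subseteq> R 1"
    proof (rule span_minimal)
      show "M \<union> N \<subseteq> R 1"
        using assms(2,3) filtration_join_base[of _ "ideal_power I M" 1 "ideal_power I N" 0]
          filtration_join_base[of _ "ideal_power I M" 0 "ideal_power I N" 1]
        unfolding R_def ideal_of_def by auto
    qed fact
    show "x \<cdot> y \<in> R (Suc k)" if "x \<in> R 1" "y \<in> R k" for k x y
      using that assms ideal_power_mult unfolding R_def by (intro filtration_join_mult) auto
    show "R (Suc (Suc p + Suc q)) \<subseteq> {0}"
      using filtration_join_trivial[of "Suc p" "ideal_power I M" "Suc q" "ideal_power I N"]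
        ideal_power_trivial pq unfolding R_def by auto
  qed simp
qed

text \<open>A nilpotent ideal of greatest dimension works: its sum with any other nilpotent ideal is
  again one, hence no larger.\<close>

lemma ex_nilradical:
  assumes "subalgebra I"
  obtains N where "ideal_of N I" "nilpotent N" "\<And>M. ideal_of M I \<Longrightarrow> nilpotent M \<Longrightarrow> M \<subseteq> N"
proof -
  obtain S where S: "finite S" "span S = UNIV" using finite_dimensional by blast
  \<comment> \<open>The locale \<open>finite_dimensional_vector_space\<close> is parametrised by a
    basis, so one is cut out of the finite spanning set.\<close>
  obtain B where B: "B \<subseteq> S" "independent B" "S \<subseteq> span B"
    using maximal_independent_subset by blast
  interpret fd: finite_dimensional_vector_space scale B
  proof
    show "finite B" using B S finite_subset by blast
    show "independent B" by fact
    show "span B = UNIV" using B S span_minimal[of S "span B"] by auto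
  qed
  define K where "K M \<longleftrightarrow> ideal_of M I \<and> nilpotent M" for M
  have "subspace I" using assms subalgebra_def by blast
  then have "K {0}"
    unfolding K_def ideal_of_def nilpotent_def
    by (auto simp: subspace_0 intro: exI[of _ 0])
  moreover have "dim M < Suc fd.dimension" for M
    using fd.dim_subset_UNIV[of M] by (rule le_imp_less_Suc)
  ultimately obtain N where N: "K N" "\<And>M. K M \<Longrightarrow> dim M \<le> dim N"
    using ex_has_greatest_nat[of K "{0}" dim "Suc fd.dimension"] by blast
  have "M \<subseteq> N" if "ideal_of M I" "nilpotent M" for M
  proof -
    have "K (span (N \<union> M))"
      using N(1) that assms \<open>subspace I\<close> unfolding K_def
      by (intro conjI ideal_of_sum nilpotent_sum[of I]) auto
    then have "dim (span (N \<union> M)) \<le> dim N" by (rule N(2))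
    moreover have "N \<subseteq> span (N \<union> M)" using span_superset by blast
    moreover have "subspace N" using N(1) unfolding K_def ideal_of_def by blast
    ultimately have "N = span (N \<union> M)"
      by (intro fd.subspace_dim_equal) auto
    then show "M \<subseteq> N" using span_superset by blast
  qed
  then show ?thesis using that N(1) unfolding K_def by blast
qed

text \<open>Adding the Leibniz identities for \<open>x, y, w\<close> and \<open>y, x, w\<close>
  cancels the nested products.\<close>

lemma mult_add_mult_mult: "(x \<cdot> y) \<cdot> w + (y \<cdot> x) \<cdot> w = 0"
  using left_leibniz[of x y w] left_leibniz[of y x w] by (simp add: algebra_simps)

text \<open>Adjoining the right multiples makes the left-stable \<open>N\<close> two-sided.
  Nilpotency survives because \<open>n x\<close> acts from the left like \<open>- (x n)\<close>, an
  element of \<open>N\<close>.\<close>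

lemma ideal_of_right_closure:
  assumes "ideal_of I J" "ideal_of N I" "nilpotent N"
    and left: "\<And>x n. x \<in> J \<Longrightarrow> n \<in> N \<Longrightarrow> x \<cdot> n \<in> N"
    and "subalgebra J"
  defines "M \<equiv> span (N \<union> {n \<cdot> x |n x. n \<in> N \<and> x \<in> J})"
  shows "ideal_of M J" "nilpotent M" "M \<subseteq> I"
proof -
  let ?S = "N \<union> {n \<cdot> x |n x. n \<in> N \<and> x \<in> J}"
  have NI: "N \<subseteq> I" "subspace N" "\<And>x y. x \<in> N \<Longrightarrow> y \<in> I \<Longrightarrow> x \<cdot> y \<in> N"
    using assms(2) by (auto simp: ideal_of_def)
  have IJ: "I \<subseteq> J" "subspace I" "\<And>x y. x \<in> I \<Longrightarrow> y \<in> J \<Longrightarrow> x \<cdot> y \<in> I"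
    using assms(1) by (auto simp: ideal_of_def)
  have J: "subspace J" "\<And>x y. x \<in> J \<Longrightarrow> y \<in> J \<Longrightarrow> x \<cdot> y \<in> J"
    using assms(5) by (auto simp: subalgebra_def)
  show MI: "M \<subseteq> I"
    unfolding M_def using NI IJ by (intro span_minimal) auto
  show "ideal_of M J"
    unfolding M_def
  proof (rule ideal_of_span)
    show "subspace J" by fact
    show "?S \<subseteq> J" using NI IJ J(2) by blast
    \<comment> \<open>Proved ahead of the other side, which writes \<open>(n y) x\<close> as
      \<open>n (y x) - y (n x)\<close> and needs this fact for the second term.\<close>
    have 1: "x \<cdot> s \<in> span ?S" if x: "x \<in> J" and s: "s \<in> ?S" for x s
    proof (cases "s \<in> N")
      case True
      then show ?thesis using left x by (simp add: span_base)
    next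
      case False
      then obtain n y where ny: "s = n \<cdot> y" "n \<in> N" "y \<in> J" using s by blast
      have "x \<cdot> n \<in> N" "x \<cdot> y \<in> J" using ny left x J(2) by simp_all
      then have "(x \<cdot> n) \<cdot> y \<in> ?S" "n \<cdot> (x \<cdot> y) \<in> ?S" using ny by blast+
      then have "(x \<cdot> n) \<cdot> y \<in> span ?S" "n \<cdot> (x \<cdot> y) \<in> span ?S"
        by (simp_all only: span_base)
      then show ?thesis unfolding ny(1) left_leibniz[of x] by (rule span_add)
    qed
    show "x \<cdot> s \<in> span ?S" if "x \<in> J" "s \<in> ?S" for x s using that by (rule 1)
    show "s \<cdot> x \<in> span ?S" if x: "x \<in> J" and s: "s \<in> ?S" for x s
    proof (cases "s \<in> N")
      case True
      then show ?thesis using x by (auto intro: span_base)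
    next
      case False
      then obtain n y where ny: "s = n \<cdot> y" "n \<in> N" "y \<in> J" using s by blast
      have "n \<cdot> (y \<cdot> x) \<in> ?S" "n \<cdot> x \<in> ?S" using ny x J(2) by blast+
      then have "n \<cdot> (y \<cdot> x) \<in> span ?S" "y \<cdot> (n \<cdot> x) \<in> span ?S"
        using 1[OF ny(3)] by (simp_all only: span_base)
      moreover have "s \<cdot> x = n \<cdot> (y \<cdot> x) - y \<cdot> (n \<cdot> x)"
        unfolding ny(1) left_leibniz[of n] by simp
      ultimately show ?thesis by (simp add: span_diff)
    qed
  qed
  have act: "\<exists>n\<in>N. \<forall>w. a \<cdot> w = n \<cdot> w" if "a \<in> M" for a
    using that unfolding M_def
  proof (induction rule: span_induct_alt)
    case base
    then show ?case using subspace_0[OF NI(2)] by (intro bexI[of _ 0]) simp_all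
  next
    case (step c a b)
    then obtain n where n: "n \<in> N" "\<And>w. b \<cdot> w = n \<cdot> w" by blast
    have "\<exists>m\<in>N. \<forall>w. a \<cdot> w = m \<cdot> w"
    proof (cases "a \<in> N")
      case False
      then obtain m x where mx: "a = m \<cdot> x" "m \<in> N" "x \<in> J" using step(1) by blast
      have "- (x \<cdot> m) \<in> N" using left mx NI(2) by (simp add: subspace_neg)
      moreover have "a \<cdot> w = - (x \<cdot> m) \<cdot> w" for w
        unfolding mx(1) neg_mult using mult_add_mult_mult[of m x w] by (simp add: eq_neg_iff_add_eq_0)
      ultimately show ?thesis by blast
    qed blast
    then obtain m where m: "m \<in> N" "\<And>w. a \<cdot> w = m \<cdot> w" by blast
    have "c *s m + n \<in> N" using m n NI(2) by (simp add: subspace_add subspace_scale)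
    then show ?case using m n by (intro bexI[of _ "c *s m + n"]) (auto simp: add_mult scale_mult)
  qed
  \<comment> \<open>By \<open>act\<close>, left factors from \<open>M\<close> may be replaced by
    ones from \<open>N\<close>. The last factor cannot, which costs one index: it lies in
    \<open>I\<close>, so its first product already falls into \<open>N\<close>.\<close>
  have lc: "lower_central M (Suc k) \<subseteq> lower_central N k" for k
  proof (induction k)
    case 0
    have "{x \<cdot> y |x y. x \<in> M \<and> y \<in> M} \<subseteq> N"
    proof clarify
      fix x y assume "x \<in> M" "y \<in> M"
      then show "x \<cdot> y \<in> N" using act[of x] MI NI(3) by force
    qed
    then show ?case using NI(2) by (simp add: span_minimal)
  next
    case (Suc k)
    have "{x \<cdot> y |x y. x \<in> M \<and> y \<in> lower_central M (Suc k)} \<subseteq>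
        {x \<cdot> y |x y. x \<in> N \<and> y \<in> lower_central N k}"
      using Suc act by fastforce
    then show ?case unfolding lower_central.simps(2)[of _ "Suc k"] lower_central.simps(2)[of N k]
      by (rule span_mono)
  qed
  obtain p where "lower_central N p = {0}" using assms(3) unfolding nilpotent_def by blast
  then have "lower_central M (Suc p) \<subseteq> {0}" using lc by blast
  moreover have "subspace M" by (simp add: M_def)
  ultimately show "nilpotent M"
    using zero_in_lower_central[of M "Suc p"] unfolding nilpotent_def by blast
qed

end


section \<open>Divided powers of left multiplication in characteristic zero\<close>

locale leibniz_algebra_char_0 = leibniz_algebra scale mult
  for scale :: "'f::field_char_0 \<Rightarrow> 'a::ab_group_add \<Rightarrow> 'a" (infixr \<open>*s\<close> 75)
    and mult :: "'a \<Rightarrow> 'a \<Rightarrow> 'a" (infixl \<open>\<cdot>\<close> 70)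
begin

text \<open>This is \<open>L_z^i / i!\<close> applied to \<open>x\<close>, the coefficient of
  \<open>t^i\<close> in \<open>exp (t L_z) x\<close>.\<close>

primrec divided_power :: "'a \<Rightarrow> nat \<Rightarrow> 'a \<Rightarrow> 'a" where
  "divided_power z 0 x = x"
| "divided_power z (Suc i) x = inverse (of_nat (Suc i)) *s (z \<cdot> divided_power z i x)"

text \<open>Division-free form of the recursion. Characteristic zero enters here, making
  \<open>of_nat (Suc i)\<close> nonzero.\<close>

lemma scale_divided_power_Suc:
  "of_nat (Suc i) *s divided_power z (Suc i) x = z \<cdot> divided_power z i x"
  by (simp del: of_nat_Suc)

lemma divided_power_add: "divided_power z i (x + y) = divided_power z i x + divided_power z i y"
  by (induction i) (simp_all add: mult_add scale_right_distrib del: of_nat_Suc)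

lemma divided_power_scale: "divided_power z i (c *s x) = c *s divided_power z i x"
  by (induction i) (simp_all add: mult_scale mult.commute del: of_nat_Suc)

lemma divided_power_zero [simp]: "divided_power z i 0 = 0"
  by (induction i) simp_all

lemma divided_power_sum: "divided_power z i (sum f A) = (\<Sum>j\<in>A. divided_power z i (f j))"
  by (induction A rule: infinite_finite_induct) (simp_all add: divided_power_add)

lemma divided_power_stable:
  "subspace I \<Longrightarrow> (\<And>x. x \<in> I \<Longrightarrow> z \<cdot> x \<in> I) \<Longrightarrow> x \<in> I \<Longrightarrow> divided_power z i x \<in> I"
  by (induction i) (simp_all add: subspace_scale del: of_nat_Suc)

lemma divided_power_divided_power:
  "divided_power z i (divided_power z k x) = of_nat ((i + k) choose i) *s divided_power z (i + k) x"
proof (induction i)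
  case (Suc i)
  have "of_nat (Suc i) *s divided_power z (Suc i) (divided_power z k x)
      = of_nat ((i + k) choose i) *s (z \<cdot> divided_power z (i + k) x)"
    unfolding scale_divided_power_Suc Suc mult_scale ..
  also have "\<dots> = of_nat (((i + k) choose i) * Suc (i + k)) *s divided_power z (Suc (i + k)) x"
    unfolding scale_divided_power_Suc[symmetric] by (simp only: scale_scale of_nat_mult)
  also have "((i + k) choose i) * Suc (i + k) = Suc i * (Suc (i + k) choose Suc i)"
    using Suc_times_binomial_eq[of "i + k" i] by (simp add: mult.commute)
  finally have "of_nat (Suc i) *s divided_power z (Suc i) (divided_power z k x)
      = of_nat (Suc i) *s (of_nat (Suc (i + k) choose Suc i) *s divided_power z (Suc (i + k)) x)"
    by (simp only: of_nat_mult scale_scale)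
  then show ?case
    unfolding scale_cancel_left by (simp del: of_nat_Suc divided_power.simps)
qed simp

text \<open>The higher Leibniz rule for the derivation \<open>L_z\<close>; dividing by factorials
  absorbs the binomial coefficients.\<close>

lemma divided_power_mult:
  "divided_power z n (x \<cdot> y) = (\<Sum>i\<le>n. divided_power z i x \<cdot> divided_power z (n - i) y)"
proof (induction n)
  case (Suc n)
  let ?d = "divided_power z"
  let ?t = "\<lambda>i. ?d i x \<cdot> ?d (Suc n - i) y"
  have "of_nat (Suc n) *s ?d (Suc n) (x \<cdot> y) = (\<Sum>i\<le>n. z \<cdot> (?d i x \<cdot> ?d (n - i) y))"
    unfolding scale_divided_power_Suc Suc mult_sum ..
  also have "\<dots> = (\<Sum>i\<le>n. of_nat (Suc i) *s ?t (Suc i)) + (\<Sum>i\<le>n. of_nat (Suc n - i) *s ?t i)"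
    unfolding sum.distrib[symmetric]
  proof (rule sum.cong)
    fix i assume "i \<in> {..n}"
    then have "Suc n - i = Suc (n - i)" by simp
    then show "z \<cdot> (?d i x \<cdot> ?d (n - i) y) =
        of_nat (Suc i) *s ?t (Suc i) + of_nat (Suc n - i) *s ?t i"
      unfolding left_leibniz[of z] scale_divided_power_Suc[symmetric]
      by (simp add: scale_mult mult_scale del: of_nat_Suc divided_power.simps)
  qed simp
  \<comment> \<open>Both sums are extended to the range up to \<open>Suc n\<close> by a term of
    weight zero; the weights \<open>i\<close> and \<open>Suc n - i\<close> then add up to
    \<open>Suc n\<close>.\<close>
  also have "(\<Sum>i\<le>n. of_nat (Suc i) *s ?t (Suc i)) = (\<Sum>i\<le>Suc n. of_nat i *s ?t i)"
    by (subst sum.atMost_Suc_shift) (simp del: of_nat_Suc divided_power.simps)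
  also have "(\<Sum>i\<le>n. of_nat (Suc n - i) *s ?t i) = (\<Sum>i\<le>Suc n. of_nat (Suc n - i) *s ?t i)"
    by simp
  also have "(\<Sum>i\<le>Suc n. of_nat i *s ?t i) + (\<Sum>i\<le>Suc n. of_nat (Suc n - i) *s ?t i)
      = of_nat (Suc n) *s (\<Sum>i\<le>Suc n. ?t i)"
    unfolding sum.distrib[symmetric] scale_left_distrib[symmetric] of_nat_add[symmetric] scale_sum_right
    by (intro sum.cong) (auto simp del: of_nat_Suc)
  finally show ?case
    unfolding scale_cancel_left by (simp del: of_nat_Suc divided_power.simps)
qed simp

section \<open>The power series algebra and the exponential automorphism\<close>

definition series_scale :: "'f \<Rightarrow> (nat \<Rightarrow> 'a) \<Rightarrow> nat \<Rightarrow> 'a" where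
  "series_scale c f = (\<lambda>n. c *s f n)"

definition series_mult :: "(nat \<Rightarrow> 'a) \<Rightarrow> (nat \<Rightarrow> 'a) \<Rightarrow> nat \<Rightarrow> 'a" where
  "series_mult f g = (\<lambda>n. \<Sum>i\<le>n. f i \<cdot> g (n - i))"

lemma vector_space_series: "vector_space series_scale"
  by unfold_locales
    (auto simp: series_scale_def scale_right_distrib scale_left_distrib fun_eq_iff)

text \<open>Power series over a nonzero algebra are infinite-dimensional, so
  \<open>leibniz_algebra\<close> cannot be interpreted in general; the filtration lemmas ask only
  for bilinearity.\<close>

interpretation series: bilinear_algebra series_scale series_mult
proof (intro bilinear_algebra.intro bilinear_algebra_axioms.intro vector_space_series)
  interpret series: vector_space series_scale by (rule vector_space_series)
  note [simp] = series_mult_def series_scale_def fun_eq_iff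
  show "Vector_Spaces.linear series_scale series_scale (\<lambda>f. series_mult f g)" for g
    by unfold_locales (auto simp: add_mult scale_mult sum.distrib scale_sum_right)
  show "Vector_Spaces.linear series_scale series_scale (\<lambda>g. series_mult f g)" for f
    by unfold_locales (auto simp: mult_add mult_scale sum.distrib scale_sum_right)
qed

text \<open>This is the action of \<open>exp (t L\<^sub>z)\<close> on power series in \<open>t\<close>.\<close>

definition exp_series :: "'a \<Rightarrow> (nat \<Rightarrow> 'a) \<Rightarrow> nat \<Rightarrow> 'a" where
  "exp_series z f = (\<lambda>n. \<Sum>i\<le>n. divided_power z i (f (n - i)))"

text \<open>By \<open>divided_power_mult\<close>, each side sums over derivative orders
  \<open>l\<close>, \<open>m\<close> and coefficient indices \<open>j\<close>, \<open>k\<close> with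
  total \<open>n\<close>; only the grouping differs.\<close>

lemma exp_series_mult:
  "exp_series z (series_mult f g) = series_mult (exp_series z f) (exp_series z g)"
proof
  fix n
  let ?d = "divided_power z"
  let ?t = "\<lambda>(l, m, j, k). ?d l (f j) \<cdot> ?d m (g k)"
  have "exp_series z (series_mult f g) n =
      (\<Sum>i\<le>n. \<Sum>j\<le>n - i. \<Sum>l\<le>i. ?d l (f j) \<cdot> ?d (i - l) (g (n - i - j)))"
    by (simp add: exp_series_def series_mult_def divided_power_sum divided_power_mult)
  also have "\<dots> = sum ?t {(l, m, j, k). l + m + j + k = n}"
    unfolding sum.Sigma[OF finite_atMost ballI[OF finite_atMost]]
      sum.Sigma[OF finite_atMost ballI[OF finite_SigmaI[OF finite_atMost finite_atMost]]]
    by (rule sum.reindex_bij_witness[where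
          i = "\<lambda>(l, m, j, k). (l + m, j, l)" and j = "\<lambda>(i, j, l). (l, i - l, j, n - i - j)"]) auto
  also have "\<dots> = (\<Sum>p\<le>n. \<Sum>m\<le>n - p. \<Sum>l\<le>p. ?d l (f (p - l)) \<cdot> ?d m (g (n - p - m)))"
    unfolding sum.Sigma[OF finite_atMost ballI[OF finite_atMost]]
      sum.Sigma[OF finite_atMost ballI[OF finite_SigmaI[OF finite_atMost finite_atMost]]]
    by (rule sum.reindex_bij_witness[where
          j = "\<lambda>(l, m, j, k). (l + j, m, l)" and i = "\<lambda>(p, m, l). (l, m, p - l, n - p - m)"]) auto
  also have "\<dots> = series_mult (exp_series z f) (exp_series z g) n"
    by (simp add: exp_series_def series_mult_def sum_mult mult_sum)
  finally show "exp_series z (series_mult f g) n = series_mult (exp_series z f) (exp_series z g) n" .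
qed

text \<open>The map is unitriangular: coefficient \<open>n\<close> is \<open>f n\<close> plus terms
  in earlier coefficients.\<close>

lemma exp_series_eq_zeroD:
  assumes "exp_series z f = 0"
  shows "f = 0"
proof
  show "f n = 0 n" for n
  proof (induction n rule: less_induct)
    case (less n)
    have "exp_series z f n = f n + (\<Sum>i\<in>{..n} - {0}. divided_power z i (f (n - i)))"
      unfolding exp_series_def by (subst sum.remove[of _ 0]) auto
    also have "(\<Sum>i\<in>{..n} - {0}. divided_power z i (f (n - i))) = 0"
      using less by (intro sum.neutral) auto
    finally show ?case using assms by simp
  qed
qed

text \<open>The argument is \<open>exp (-t L_z) x\<close>, the result the constant series
  \<open>x\<close>. The alternating sum of binomial coefficients kills every positive
  degree.\<close>

lemma exp_series_inverse:
  "exp_series z (\<lambda>n. (-1) ^ n *s divided_power z n x) = (\<lambda>n. if n = 0 then x else 0)"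
proof
  fix n
  have "exp_series z (\<lambda>n. (-1) ^ n *s divided_power z n x) n
      = (\<Sum>i\<le>n. ((-1) ^ (n - i) * of_nat (n choose i)) *s divided_power z n x)"
    unfolding exp_series_def
    by (intro sum.cong) (simp_all add: divided_power_scale divided_power_divided_power)
  also have "\<dots> = (\<Sum>i\<le>n. (-1) ^ i * of_nat (n choose i)) *s divided_power z n x"
    unfolding scale_sum_left[symmetric]
    by (rule arg_cong[where f = "\<lambda>c. c *s _"],
        rule sum.reindex_bij_witness[of _ "\<lambda>i. n - i" "\<lambda>i. n - i"])
      (auto simp: binomial_symmetric[symmetric])
  also have "\<dots> = (if n = 0 then x else 0)"
    using choose_alternating_sum[of n, where 'a = 'f] by auto
  finally show "exp_series z (\<lambda>n. (-1) ^ n *s divided_power z n x) n = (if n = 0 then x else 0)" .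
qed

section \<open>Left translates of nilpotent ideals and ascent along a chain\<close>

lemma left_translate_ideal:
  assumes "subalgebra I" "ideal_of N I" "\<And>x. x \<in> I \<Longrightarrow> z \<cdot> x \<in> I"
  shows "ideal_of (span (N \<union> (\<lambda>n. z \<cdot> n) ` N)) I"
proof (rule ideal_of_span)
  let ?S = "N \<union> (\<lambda>n. z \<cdot> n) ` N"
  have NI: "N \<subseteq> I" "subspace N" "\<And>x y. x \<in> N \<Longrightarrow> y \<in> I \<Longrightarrow> x \<cdot> y \<in> N"
    "\<And>x y. x \<in> N \<Longrightarrow> y \<in> I \<Longrightarrow> y \<cdot> x \<in> N"
    using assms(2) by (auto simp: ideal_of_def)
  show "subspace I" using assms(1) by (simp add: subalgebra_def)
  show "?S \<subseteq> I" using NI(1) assms(3) by blast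
  fix x s assume x: "x \<in> I" and s: "s \<in> ?S"
  show "x \<cdot> s \<in> span ?S"
  proof (cases "s \<in> N")
    case False
    then obtain n where n: "s = z \<cdot> n" "n \<in> N" using s by blast
    \<comment> \<open>The Leibniz identity moves \<open>z\<close> to the outside or next to
      \<open>x\<close>; \<open>z x\<close> stays in \<open>I\<close>, so both products with
      \<open>n\<close> are controlled by \<open>N\<close>.\<close>
    have "x \<cdot> s = z \<cdot> (x \<cdot> n) - (z \<cdot> x) \<cdot> n"
      unfolding n(1) left_leibniz[of z] by simp
    moreover have "z \<cdot> (x \<cdot> n) \<in> span ?S" "(z \<cdot> x) \<cdot> n \<in> span ?S"
      using n x NI assms(3) by (auto intro: span_base)
    ultimately show ?thesis by (simp add: span_diff)
  qed (use x NI in \<open>auto intro: span_base\<close>)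
  show "s \<cdot> x \<in> span ?S"
  proof (cases "s \<in> N")
    case False
    then obtain n where n: "s = z \<cdot> n" "n \<in> N" using s by blast
    have "s \<cdot> x = z \<cdot> (n \<cdot> x) - n \<cdot> (z \<cdot> x)"
      unfolding n(1) left_leibniz[of z] by simp
    moreover have "z \<cdot> (n \<cdot> x) \<in> span ?S" "n \<cdot> (z \<cdot> x) \<in> span ?S"
      using n x NI assms(3) by (auto intro: span_base)
    ultimately show ?thesis by (simp add: span_diff)
  qed (use x NI in \<open>auto intro: span_base\<close>)
qed

text \<open>Leading coefficients multiply when the order in \<open>t\<close> matches the filtration
  degree: a series starting at \<open>t\<close> times one starting at \<open>t^k\<close> can only
  start at \<open>t^(k+1)\<close> or later. So \<open>G\<close> inherits nilpotency from
  \<open>R\<close>.\<close>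

lemma left_translate_nilpotent:
  assumes "subalgebra I" "ideal_of N I" "nilpotent N" "\<And>x. x \<in> I \<Longrightarrow> z \<cdot> x \<in> I"
  shows "nilpotent (span (N \<union> (\<lambda>n. z \<cdot> n) ` N))"
proof -
  let ?S = "N \<union> (\<lambda>n. z \<cdot> n) ` N"
  have sub: "subspace I" "subspace N" "N \<subseteq> I"
    using assms(1,2) by (auto simp: subalgebra_def ideal_of_def)
  \<comment> \<open>\<open>Q\<close> is the filtration of the translated ideal: the preimage of \<open>P\<close> under \<open>exp (t L\<^sub>z)\<close>.
    \<open>G k\<close> collects the coefficients of \<open>t\<^sup>k\<close> in the multiples of \<open>t\<^sup>k\<close> in \<open>R k\<close>.\<close>
  define P where "P i = {f. \<forall>n :: nat. f n \<in> ideal_power I N i}" for i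
  define Q where "Q i = {f. exp_series z f \<in> P i}" for i
  define R where "R = series.filtration_join P Q"
  define G where "G k = {f k |f. f \<in> R k \<and> (\<forall>i<k. f i = 0)}" for k
  have G_E: thesis if "x \<in> G k" "\<And>f. f \<in> R k \<Longrightarrow> x = f k \<Longrightarrow> \<forall>i<k. f i = 0 \<Longrightarrow> thesis"
    for x k thesis
    using that(1) unfolding G_def mem_Collect_eq by (elim exE conjE) (rule that(2); assumption)
  have R_sub: "series.subspace (R k)" for k
    by (simp add: R_def series.filtration_join_def)
  have P_mult: "series_mult f g \<in> P (i + k)" if "i \<le> 1" "f \<in> P i" "g \<in> P k" for i k f g
    using that ideal_power_mult[OF assms(1,2) that(1)] subspace_ideal_power[OF sub(1,2)]
    unfolding P_def series_mult_def by (auto intro!: subspace_sum)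
  \<comment> \<open>The product rule for \<open>Q\<close> is that of \<open>P\<close> pulled back
    along the homomorphism \<open>exp_series z\<close>.\<close>
  have R_mult: "series_mult f g \<in> R (Suc k)" if "f \<in> R 1" "g \<in> R k" for f g k
    using that unfolding R_def
    by (rule series.filtration_join_mult[rotated -2])
      (use P_mult in \<open>auto simp: Q_def exp_series_mult\<close>)
  obtain p where p: "lower_central N p = {0}"
    using assms(3) unfolding nilpotent_def by blast
  have P_triv: "P i \<subseteq> {0}" if "Suc p \<le> i" for i
    using ideal_power_trivial[OF p that, of I] unfolding P_def by (fastforce simp: fun_eq_iff)
  have Q_triv: "Q i \<subseteq> {0}" if "Suc p \<le> i" for i
    using P_triv[OF that] exp_series_eq_zeroD by (auto simp: Q_def)
  show ?thesis
  proof (rule nilpotent_filtration)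
    show "subspace (G k)" for k
      unfolding subspace_def
    proof (intro conjI ballI allI)
      show "0 \<in> G k"
        unfolding G_def using series.subspace_0[OF R_sub, of k]
        by (intro CollectI exI[of _ 0]) simp
      show "x + y \<in> G k" if "x \<in> G k" "y \<in> G k" for x y
      proof -
        obtain f where "f \<in> R k" "x = f k" "\<forall>i<k. f i = 0"
          using \<open>x \<in> G k\<close> by (rule G_E)
        moreover obtain g where "g \<in> R k" "y = g k" "\<forall>i<k. g i = 0"
          using \<open>y \<in> G k\<close> by (rule G_E)
        ultimately show ?thesis
          unfolding G_def using series.subspace_add[OF R_sub]
          by (intro CollectI exI[of _ "f + g"]) simp
      qed
      show "c *s x \<in> G k" if "x \<in> G k" for c x
      proof -
        obtain f where "f \<in> R k" "x = f k" "\<forall>i<k. f i = 0"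
          using \<open>x \<in> G k\<close> by (rule G_E)
        then show ?thesis
          unfolding G_def using series.subspace_scale[OF R_sub]
          by (intro CollectI exI[of _ "series_scale c f"]) (simp add: series_scale_def)
      qed
    qed
    then show "span ?S \<subseteq> G 1"
    proof (rule span_minimal[rotated], intro Un_least image_subsetI subsetI)
      fix x assume x: "x \<in> N"
      have dI: "divided_power z i x \<in> I" for i
        using x sub assms(4) by (intro divided_power_stable) auto
      show "x \<in> G 1"
      proof -
        \<comment> \<open>The series \<open>t x\<close>; its membership in \<open>Q 0\<close> needs
          only that \<open>z\<close> preserves \<open>I\<close>.\<close>
        let ?f = "\<lambda>n. if n = 1 then x else 0"
        have "?f \<in> P 1"
          using x sub by (auto simp: P_def subspace_0)
        moreover have "?f \<in> Q 0"
          using x dI sub by (auto simp: Q_def P_def exp_series_def intro!: subspace_sum subspace_0)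
        ultimately have "?f \<in> R 1"
          using series.filtration_join_base[of ?f P 1 Q 0] by (simp add: R_def)
        then show ?thesis unfolding G_def by (intro CollectI exI[of _ ?f]) simp
      qed
      show "z \<cdot> x \<in> G 1"
      proof -
        \<comment> \<open>\<open>x - exp (-t L\<^sub>z) x\<close> is in the sum of the two ideals and starts with \<open>t (z x)\<close>\<close>
        let ?f = "\<lambda>n. if n = 0 then x else 0" and ?g = "\<lambda>n. (-1) ^ n *s divided_power z n x"
        have "?f \<in> P 1"
          using x sub by (auto simp: P_def subspace_0)
        moreover have "exp_series z ?f n = divided_power z n x" for n
          unfolding exp_series_def by (subst sum.remove[of _ n]) (auto intro!: sum.neutral)
        then have "?f \<in> Q 0"
          using dI by (simp add: Q_def P_def)
        ultimately have f: "?f \<in> R 1"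
          using series.filtration_join_base[of ?f P 1 Q 0] by (simp add: R_def)
        have "?g \<in> Q 1" "?g \<in> P 0"
          using \<open>?f \<in> P 1\<close> dI sub by (auto simp: Q_def exp_series_inverse P_def subspace_scale)
        then have "?g \<in> R 1"
          using series.filtration_join_base[of ?g P 0 Q 1] by (simp add: R_def)
        with f have "?f - ?g \<in> R 1"
          by (rule series.subspace_diff[OF R_sub])
        then show ?thesis unfolding G_def by (intro CollectI exI[of _ "?f - ?g"]) simp
      qed
    qed
    show "x \<cdot> y \<in> G (Suc k)" if "x \<in> G 1" "y \<in> G k" for k x y
    proof -
      obtain f where f: "f \<in> R 1" "x = f 1" "\<forall>i<1. f i = 0"
        using \<open>x \<in> G 1\<close> by (rule G_E)
      obtain g where g: "g \<in> R k" "y = g k" "\<forall>i<k. g i = 0"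
        using \<open>y \<in> G k\<close> by (rule G_E)
      \<comment> \<open>Up to degree \<open>Suc k\<close>, the only convolution term that can
        survive is \<open>f 1\<close> times \<open>g k\<close>.\<close>
      have "f i \<cdot> g (n - i) = 0" if "n \<le> Suc k" "i \<le> n" "(n, i) \<noteq> (Suc k, 1)" for i n
        using f(3) g(3) that by (cases "i = 0"; cases "n - i < k") auto
      then have "series_mult f g (Suc k) = x \<cdot> y" "\<And>n. n < Suc k \<Longrightarrow> series_mult f g n = 0"
        unfolding series_mult_def f(2) g(2)
        by (subst sum.remove[of _ 1], auto intro!: sum.neutral)
      then show ?thesis
        unfolding G_def using R_mult[OF f(1) g(1)] by (intro CollectI exI[of _ "series_mult f g"]) simp
    qed
    have "R (Suc p + Suc p) = {0}"
      unfolding R_def using P_triv Q_triv by (intro series.filtration_join_trivial) auto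
    then show "G (Suc (p + Suc p)) \<subseteq> {0}" by (auto simp: G_def)
  qed simp
qed

text \<open>\<open>B\<close> is first enlarged to the nilradical of \<open>I\<close>, whose
  maximality absorbs every left translate by \<open>J\<close>; right multiples are adjoined
  afterwards.\<close>

lemma ideal_chain_nilpotent:
  assumes "subalgebra J" "subalgebra I" "ideal_of I J" "ideal_of B I" "nilpotent B"
  obtains N where "ideal_of N J" "nilpotent N" "B \<subseteq> N"
proof -
  obtain N where N: "ideal_of N I" "nilpotent N" "\<And>M. ideal_of M I \<Longrightarrow> nilpotent M \<Longrightarrow> M \<subseteq> N"
    using ex_nilradical[OF assms(2)] by blast
  have left: "x \<cdot> n \<in> N" if "x \<in> J" "n \<in> N" for x n
  proof -
    have "span (N \<union> (\<lambda>n. x \<cdot> n) ` N) \<subseteq> N"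
    proof (rule N(3))
      have "x \<cdot> y \<in> I" if "y \<in> I" for y
        using assms(3) \<open>x \<in> J\<close> that by (simp add: ideal_of_def)
      then show "ideal_of (span (N \<union> (\<lambda>n. x \<cdot> n) ` N)) I"
        "nilpotent (span (N \<union> (\<lambda>n. x \<cdot> n) ` N))"
        using left_translate_ideal[OF assms(2) N(1)] left_translate_nilpotent[OF assms(2) N(1,2)]
        by blast+
    qed
    moreover have "x \<cdot> n \<in> span (N \<union> (\<lambda>n. x \<cdot> n) ` N)"
      using \<open>n \<in> N\<close> by (intro span_base) simp
    ultimately show ?thesis by (rule subsetD)
  qed
  let ?M = "span (N \<union> {n \<cdot> x |n x. n \<in> N \<and> x \<in> J})"
  have "ideal_of ?M J" "nilpotent ?M"
    using ideal_of_right_closure[OF assms(3) N(1,2) left assms(1)] by auto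
  moreover have "B \<subseteq> ?M"
    by (rule order_trans[OF N(3)[OF assms(4,5)] order_trans[OF Un_upper1 span_superset]])
  ultimately show ?thesis by (rule that)
qed

lemma subinvariant_nilpotent_in_ideal:
  assumes "nilpotent B" "subinvariant B"
  obtains N where "ideal_of N UNIV" "nilpotent N" "B \<subseteq> N"
proof -
  define chain where "chain t S \<longleftrightarrow> S 0 = UNIV \<and> S t = B \<and> (\<forall>i\<le>t. subalgebra (S i)) \<and>
    (\<forall>i. 1 \<le> i \<and> i \<le> t \<longrightarrow> ideal_of (S i) (S (i - 1)))" for t and S :: "nat \<Rightarrow> 'a set"
  obtain t S where "chain t S"
    using assms(2) unfolding subinvariant_def chain_def[symmetric] by blast
  then have S: "S 0 = UNIV" "S t = B" "\<And>i. i \<le> t \<Longrightarrow> subalgebra (S i)"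
    "\<And>i. 1 \<le> i \<Longrightarrow> i \<le> t \<Longrightarrow> ideal_of (S i) (S (i - 1))"
    unfolding chain_def by simp_all
  \<comment> \<open>Induction runs down the index from \<open>t\<close> to \<open>0\<close>,
    starting with \<open>B\<close> as an ideal of itself.\<close>
  have "\<exists>N. ideal_of N (S 0) \<and> nilpotent N \<and> B \<subseteq> N"
    using le0[of t]
  proof (induction rule: inc_induct)
    case base
    then show ?case
      using S(3)[of t] assms(1) S(2) unfolding subalgebra_def ideal_of_def by auto
  next
    case (step i)
    then obtain M where "ideal_of M (S (Suc i))" "nilpotent M" "B \<subseteq> M" by blast
    moreover have "ideal_of (S (Suc i)) (S i)"
      using S(4)[of "Suc i"] step.hyps by simp
    moreover have "subalgebra (S i)" "subalgebra (S (Suc i))"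
      using S(3) step.hyps by simp_all
    ultimately obtain N where "ideal_of N (S i)" "nilpotent N" "M \<subseteq> N"
      using ideal_chain_nilpotent[of "S i" "S (Suc i)" M] by metis
    then show ?case
      using \<open>B \<subseteq> M\<close> by blast
  qed
  then show ?thesis using that S(1) by auto
qed

end

section \<open>Subalgebras of a nilpotent ideal\<close>

context leibniz_algebra
begin

lemma ideal_of_imp_subalgebra: "ideal_of I J \<Longrightarrow> subalgebra I"
  unfolding ideal_of_def subalgebra_def by blast

lemma subalgebra_generated: "subalgebra (generated_subalgebra X)"
  unfolding generated_subalgebra_def
proof (rule hull_in)
  show "subalgebra (\<Inter>T)" if "Ball T subalgebra" for T
    using that unfolding subalgebra_def by (simp add: subspace_Inter)
qed

lemma lower_central_mono: "D \<subseteq> N \<Longrightarrow> lower_central D k \<subseteq> lower_central N k"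
proof (induction k)
  case (Suc k)
  then show ?case unfolding lower_central.simps by (intro span_mono) blast
qed simp

lemma nilpotent_subalgebra:
  assumes "subspace D" "D \<subseteq> N" "nilpotent N"
  shows "nilpotent D"
  using assms lower_central_mono[OF assms(2)] zero_in_lower_central[OF assms(1)]
  unfolding nilpotent_def by blast

text \<open>The powers are built by left factors from \<open>N\<close> only;
  \<open>(a b) y = a (b y) - b (a y)\<close> reduces a longer left factor to these. Index
  \<open>i\<close> means \<open>i + 1\<close> factors, hence the \<open>Suc\<close>.\<close>

lemma lower_central_mult:
  assumes "x \<in> lower_central N i" "y \<in> lower_central N j"
  shows "x \<cdot> y \<in> lower_central N (Suc (i + j))"
  using assms
proof (induction i arbitrary: x y j)
  case 0
  then show ?case by (auto intro!: span_base)
next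
  case (Suc i)
  have "x \<in> span {x \<cdot> y |x y. x \<in> N \<and> y \<in> lower_central N i}"
    using Suc.prems by simp
  then show ?case
  proof (rule mult_span_left)
    show "subspace (lower_central N (Suc (Suc i + j)))" by simp
    fix t
    assume "t \<in> {x \<cdot> y |x y. x \<in> N \<and> y \<in> lower_central N i}"
    then obtain a b where ab: "t = a \<cdot> b" "a \<in> N" "b \<in> lower_central N i" by blast
    have left: "a \<cdot> w \<in> lower_central N (Suc k)" if "w \<in> lower_central N k" for w k
      using that ab(2) by (auto intro!: span_base)
    have "a \<cdot> (b \<cdot> y) \<in> lower_central N (Suc (Suc (i + j)))"
      using Suc.IH[OF ab(3) Suc.prems(2)] by (rule left)
    moreover have "b \<cdot> (a \<cdot> y) \<in> lower_central N (Suc (i + Suc j))"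
      using Suc.IH[OF ab(3) left[OF Suc.prems(2)]] .
    moreover have "t \<cdot> y = a \<cdot> (b \<cdot> y) - b \<cdot> (a \<cdot> y)"
      unfolding ab(1) left_leibniz[of a] by simp
    ultimately show "t \<cdot> y \<in> lower_central N (Suc (Suc i + j))"
      by (simp add: span_diff)
  qed
qed

lemma lower_central_Suc_subset:
  assumes "subalgebra N"
  shows "lower_central N (Suc k) \<subseteq> lower_central N k"
proof -
  have "{x \<cdot> y |x y. x \<in> N \<and> y \<in> lower_central N k} \<subseteq> lower_central N k"
    using assms lower_central_left_stable[of N N] by (auto simp: subalgebra_def)
  then show ?thesis
    using assms by (simp add: span_minimal subspace_lower_central subalgebra_def)
qed

lemma lower_central_subset: "subalgebra N \<Longrightarrow> lower_central N k \<subseteq> N"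
proof (induction k)
  case (Suc k)
  then show ?case using lower_central_Suc_subset[of N k] by blast
qed simp

text \<open>Modulo the next power of \<open>N\<close>, the current power is annihilated on both
  sides by \<open>N\<close>, so enlarging \<open>D\<close> by that next power gives an ideal in the
  preceding term.\<close>

lemma subinvariant_subalgebra:
  assumes "ideal_of N UNIV" "nilpotent N" "subalgebra D" "D \<subseteq> N"
  shows "subinvariant D"
proof -
  \<comment> \<open>the chain is \<open>UNIV\<close>, \<open>N = D + N\<^sup>1\<close>, \<open>D + N\<^sup>2\<close>, ..., \<open>D\<close>\<close>
  define T where "T i = span (D \<union> lower_central N i)" for i
  define S where "S i = (case i of 0 \<Rightarrow> UNIV | Suc i \<Rightarrow> T i)" for i
  have N: "subalgebra N" "subspace N" and D: "subspace D"
    using assms(1,3) ideal_of_imp_subalgebra by (auto simp: subalgebra_def)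
  obtain p where p: "lower_central N p = {0}" using assms(2) unfolding nilpotent_def by blast
  have "D \<union> N = N" using assms(4) by blast
  then have T0: "T 0 = N" using N(2) by (simp add: T_def span_eq_iff)
  have "D \<union> {0} = D" using subspace_0[OF D] by blast
  then have Tp: "T p = D" using D p by (simp add: T_def span_eq_iff)
  have stable: "x \<cdot> y \<in> lower_central N k" if "x \<in> N" "y \<in> lower_central N k" for x y k
    using N(1) that lower_central_left_stable[of N N] by (auto simp: subalgebra_def)
  have T_ideal: "ideal_of (T (Suc i)) (T i)" for i
    unfolding T_def
  proof (rule ideal_of_span)
    let ?S = "D \<union> lower_central N (Suc i)"
    show "?S \<subseteq> span (D \<union> lower_central N i)"
      using lower_central_Suc_subset[OF N(1), of i]
      by (meson Un_mono order_refl order_trans span_superset)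
    have mem: "w \<in> span ?S" if "w \<in> D \<or> w \<in> lower_central N (Suc i)" for w
      using that by (intro span_base) blast
    have SN: "?S \<subseteq> N"
      using assms(4) lower_central_subset[OF N(1)] by blast
    fix x s
    assume x: "x \<in> span (D \<union> lower_central N i)" and s: "s \<in> ?S"
    \<comment> \<open>Index \<open>0\<close> is \<open>N\<close> itself; in this form
      \<open>lower_central_mult\<close> raises the index of the other factor by one.\<close>
    have sN: "s \<in> lower_central N 0" using s SN by auto
    show "x \<cdot> s \<in> span ?S"
      using x subspace_span
    proof (rule mult_span_left)
      fix t assume t: "t \<in> D \<union> lower_central N i"
      show "t \<cdot> s \<in> span ?S"
      proof (cases "t \<in> D")
        case True
        then show ?thesis
          using s stable[of t s "Suc i"] assms(3,4) unfolding subalgebra_def by (intro mem) blast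
      next
        case False
        then show ?thesis
          using t lower_central_mult[OF _ sN, of t i] by (intro mem) simp
      qed
    qed
    show "s \<cdot> x \<in> span ?S"
      using x subspace_span
    proof (rule mult_span_right)
      fix t assume t: "t \<in> D \<union> lower_central N i"
      show "s \<cdot> t \<in> span ?S"
      proof (cases "t \<in> lower_central N i")
        case True
        then show ?thesis
          using lower_central_mult[OF sN, of t i] by (intro mem) simp
      next
        case False
        then have tD: "t \<in> D" using t by simp
        then have tN: "t \<in> lower_central N 0" using assms(4) by auto
        have "s \<cdot> t \<in> lower_central N (Suc i)" if "s \<in> lower_central N (Suc i)"
        proof -
          have "s \<cdot> t \<in> lower_central N (Suc i + 1)"
            using lower_central_mult[OF that tN] by (simp only: add_0_right Suc_eq_plus1)
          then show ?thesis
            using lower_central_Suc_subset[OF N(1), of "Suc i"] by auto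
        qed
        then show ?thesis
          using s tD assms(3) unfolding subalgebra_def by (intro mem) blast
      qed
    qed
  qed simp
  have T_sub: "subalgebra (T i)" for i
    by (cases i) (use T0 N(1) T_ideal ideal_of_imp_subalgebra in auto)
  have S_ideal: "ideal_of (S (Suc i)) (S i)" for i
    using assms(1) T0 T_ideal by (cases i) (simp_all add: S_def)
  have "subalgebra (S i)" for i
    using T_sub by (cases i) (simp_all add: S_def subalgebra_def)
  moreover have "ideal_of (S i) (S (i - 1))" if "1 \<le> i" for i
    using S_ideal[of "i - 1"] that by simp
  moreover have "S 0 = UNIV" "S (Suc p) = D"
    by (simp_all add: S_def Tp)
  ultimately show ?thesis
    unfolding subinvariant_def by (intro exI[of _ "Suc p"] exI[of _ S]) blast
qed

end

theorem lemma3p11: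
  fixes scale :: "'f::field_char_0 \<Rightarrow> 'a::ab_group_add \<Rightarrow> 'a"
    and mult :: "'a \<Rightarrow> 'a \<Rightarrow> 'a"
    and B C D :: "'a set"
  assumes "leibniz_algebra scale mult"
    and "leibniz_algebra.subalgebra scale mult B"
    and "leibniz_algebra.nilpotent scale mult B"
    and "leibniz_algebra.subinvariant scale mult B"
    and "leibniz_algebra.subalgebra scale mult C"
    and "leibniz_algebra.nilpotent scale mult C"
    and "leibniz_algebra.subinvariant scale mult C"
    and "D = leibniz_algebra.generated_subalgebra scale mult (B \<union> C)"
  shows "leibniz_algebra.subalgebra scale mult D
    \<and> leibniz_algebra.nilpotent scale mult D
    \<and> leibniz_algebra.subinvariant scale mult D"
proof -
  interpret leibniz_algebra scale mult by fact
  \<comment> \<open>No further axiom is to be checked: the class \<open>field_char_0\<close> of the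
    scalar type carries the characteristic.\<close>
  interpret leibniz_algebra_char_0 scale mult by unfold_locales
  have UNIV: "subalgebra UNIV" by (simp add: subalgebra_def)
  obtain M where M: "ideal_of M UNIV" "nilpotent M" "B \<subseteq> M"
    using subinvariant_nilpotent_in_ideal[OF assms(3,4)] .
  obtain N where N: "ideal_of N UNIV" "nilpotent N" "C \<subseteq> N"
    using subinvariant_nilpotent_in_ideal[OF assms(6,7)] .
  define K where "K = span (M \<union> N)"
  have K: "ideal_of K UNIV" "nilpotent K"
    unfolding K_def using ideal_of_sum nilpotent_sum[OF UNIV] M N by simp_all
  have "B \<union> C \<subseteq> K"
    unfolding K_def using M(3) N(3) span_superset[of "M \<union> N"] by blast
  then have "D \<subseteq> K"
    unfolding assms(8) generated_subalgebra_def
    using ideal_of_imp_subalgebra[OF K(1)] by (rule hull_minimal)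
  moreover have D: "subalgebra D"
    unfolding assms(8) by (rule subalgebra_generated)
  ultimately show ?thesis
    using subinvariant_subalgebra[OF K] nilpotent_subalgebra[of D K] K(2)
    unfolding subalgebra_def by blast
qed

end
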